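(* Let $a<b$ be real numbers, let $\alpha>0$, let $n\in\mathbb{N}$, $n\ge 1$, and let $x\in C^n[a,b]$. Then for every $t\in(a,b]$, $$ {_aI_t^\alpha}x(t)=\sum_{i=0}^{n-1}A_i(\alpha)(t-a)^{\alpha+i}x^{(i)}(t)+\sum_{p=n}^\infty B(\alpha,p)(t-a)^{\alpha+n-1-p}V_p(t), $$ where, for $i=0,\ldots,n-1$, $$ A_i(\alpha)=\frac{1}{\Gamma(\alpha+i+1)}\left[1+\sum_{p=n-i}^\infty\frac{\Gamma(p-\alpha-n+1)}{\Gamma(-\alpha-i)\,(p-n+1+i)!}\right], $$ and, for $p=n,n+1,\ldots$, $$ B(\alpha,p)=\frac{\Gamma(p-\alpha-n+1)}{\Gamma(\alpha)\Gamma(1-\alpha)\,(p-n+1)!},\qquad V_p(t)=\int_a^t (p-n+1)(\tau-a)^{p-n}x(\tau)\,d\tau . $$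
   Context: For $\alpha>0$ and an integrable function $x$ on $[a,b]$, the left Riemann--Liouville fractional integral of order $\alpha$ is $$ {_aI_t^\alpha}x(t)=\frac{1}{\Gamma(\alpha)}\int_a^t (t-\tau)^{\alpha-1}x(\tau)\,d\tau,\qquad t\in[a,b], $$ where $\Gamma$ is Euler's Gamma function. Quotients of Gamma functions whose arguments differ by a nonnegative integer are read as $\Gamma(c+k)/\Gamma(c)=c(c+1)\cdots(c+k-1)$ (equal to $1$ for $k=0$); this gives them a meaning also when $\alpha$ is an integer. Thus $\Gamma(p-\alpha-n+1)/\Gamma(-\alpha-i)$ is this product with $c=-\alpha-i$, $k=p-n+1+i$, and $\Gamma(p-\alpha-n+1)/\Gamma(1-\alpha)$ is this product with $c=1-\alpha$, $k=p-n$. *)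

theory Defs
  imports "HOL-Analysis.Analysis"
begin

(* Iterated derivative relative to S: for S = {a..b} it is the one-sided derivative at the
   end points, so no values of x outside S matter. *)
primrec deriv_within :: "real set \<Rightarrow> nat \<Rightarrow> (real \<Rightarrow> real) \<Rightarrow> real \<Rightarrow> real" where
  "deriv_within S 0 x = x"
| "deriv_within S (Suc i) x = (\<lambda>t. vector_derivative (deriv_within S i x) (at t within S))"

definition Cn_on :: "nat \<Rightarrow> real set \<Rightarrow> (real \<Rightarrow> real) \<Rightarrow> bool" where
  "Cn_on n S x \<longleftrightarrow>
     (\<forall>i<n. deriv_within S i x differentiable_on S) \<and> continuous_on S (deriv_within S n x)"

(* At tau = t the library's convention 0 powr r = 0 applies; a single point does not affect
   the Lebesgue integral. *)
definition RL_integral :: "real \<Rightarrow> real \<Rightarrow> (real \<Rightarrow> real) \<Rightarrow> real \<Rightarrow> real" where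
  "RL_integral a \<alpha> x t =
     1 / Gamma \<alpha> * (LBINT \<tau>:{a..t}. (t - \<tau>) powr (\<alpha> - 1) * x \<tau>)"

(* Gamma(c + k) / Gamma(c) is read as pochhammer c k = c (c + 1) ... (c + k - 1), which is
   meaningful also at the poles of Gamma. Here c = -alpha - i and k = p - n + 1 + i; the
   latter is written p + 1 + i - n so that natural subtraction does not truncate for
   n - i \<le> p < n. *)
definition A_term :: "real \<Rightarrow> nat \<Rightarrow> nat \<Rightarrow> nat \<Rightarrow> real" where
  "A_term \<alpha> n i p = pochhammer (- \<alpha> - real i) (p + 1 + i - n) / fact (p + 1 + i - n)"

definition A_coeff :: "real \<Rightarrow> nat \<Rightarrow> nat \<Rightarrow> real" where
  "A_coeff \<alpha> n i = 1 / Gamma (\<alpha> + real i + 1) * (1 + (\<Sum>k. A_term \<alpha> n i (n - i + k)))"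

(* pochhammer (1 - alpha) (p - n) is the quotient Gamma(p - alpha - n + 1) / Gamma(1 - alpha). *)
definition B_coeff :: "real \<Rightarrow> nat \<Rightarrow> nat \<Rightarrow> real" where
  "B_coeff \<alpha> n p = pochhammer (1 - \<alpha>) (p - n) / (Gamma \<alpha> * fact (p - n + 1))"

definition V_moment :: "real \<Rightarrow> nat \<Rightarrow> (real \<Rightarrow> real) \<Rightarrow> nat \<Rightarrow> real \<Rightarrow> real" where
  "V_moment a n x p t = (LBINT \<tau>:{a..t}. real (p - n + 1) * (\<tau> - a) ^ (p - n) * x \<tau>)"

definition B_term :: "real \<Rightarrow> real \<Rightarrow> nat \<Rightarrow> (real \<Rightarrow> real) \<Rightarrow> real \<Rightarrow> nat \<Rightarrow> real" where
  "B_term a \<alpha> n x t p =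
     B_coeff \<alpha> n p * (t - a) powr (\<alpha> + real n - 1 - real p) * V_moment a n x p t"

end

(* Every A_i vanishes: its bracket is the binomial series of (1 - z)^(alpha + i) at z = 1. What
   remains is the expansion of (t - tau)^(alpha - 1) in powers of (tau - a)/(t - a), integrated
   termwise. The singularity at tau = t is harmless because integrating the k-th power gains a
   factor 1/(k + 1), turning coefficients of order k^(-alpha) into an absolutely convergent
   series. *)
theory Submission
  imports Defs "HOL-Real_Asymp.Real_Asymp"
begin

text \<open>Hockey-stick identity: \<open>pochhammer c k / fact k\<close> are the coefficients of (1
  - z)^(-c), and dividing by 1 - z forms partial sums while raising c by one. In the induction step
  \<open>pochhammer_rec\<close> splits off the first factor c, which exposes the common factor
  \<open>pochhammer (c + 1) m\<close>.\<close>

lemma sum_pochhammer_over_fact: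
  fixes c :: "'a :: field_char_0"
  shows "(\<Sum>k\<le>m. pochhammer c k / fact k) = pochhammer (c + 1) m / fact m"
proof (induction m)
  case (Suc m)
  have "pochhammer (c + 1) m / fact m + pochhammer c (Suc m) / fact (Suc m)
      = pochhammer (c + 1) m * (of_nat (Suc m) + c) / fact (Suc m)"
    unfolding pochhammer_rec[of c] by (simp add: field_simps del: of_nat_Suc)
  also have "\<dots> = pochhammer (c + 1) (Suc m) / fact (Suc m)"
    unfolding pochhammer_Suc by (simp add: algebra_simps)
  finally show ?case using Suc.IH by simp
qed auto

text \<open>Brings in the asymptotics of the coefficients: \<open>rGamma_series c\<close> converges
  for every c, also at the poles of Gamma, so the coefficients are O(m^(c - 1)).\<close>

lemma pochhammer_over_fact_eq_rGamma_series:
  fixes c :: real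
  assumes "m > 0"
  shows "pochhammer c (Suc m) / fact (Suc m) = rGamma_series c m * (real m powr c / real (Suc m))"
  using assms by (simp add: rGamma_series_def powr_def divide_simps)

lemma pochhammer_over_fact_tendsto_0:
  fixes \<beta> :: real
  assumes "\<beta> > 0"
  shows "(\<lambda>m. pochhammer (1 - \<beta>) m / fact m) \<longlonglongrightarrow> 0"
proof -
  have "(\<lambda>m. real m powr (1 - \<beta>) / real (Suc m)) \<longlonglongrightarrow> 0"
    using assms by real_asymp
  then have "(\<lambda>m. rGamma_series (1 - \<beta>) m * (real m powr (1 - \<beta>) / real (Suc m)))
      \<longlonglongrightarrow> rGamma (1 - \<beta>) * 0"
    by (intro tendsto_mult rGamma_series_LIMSEQ)
  moreover have "\<forall>\<^sub>F m in sequentially.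
      rGamma_series (1 - \<beta>) m * (real m powr (1 - \<beta>) / real (Suc m))
      = pochhammer (1 - \<beta>) (Suc m) / fact (Suc m)"
    using eventually_gt_at_top[of 0]
    by eventually_elim (simp only: pochhammer_over_fact_eq_rGamma_series)
  ultimately have "(\<lambda>m. pochhammer (1 - \<beta>) (Suc m) / fact (Suc m)) \<longlonglongrightarrow> 0"
    by (auto dest: Lim_transform_eventually)
  then show ?thesis by (rule LIMSEQ_imp_Suc)
qed

text \<open>The binomial series of (1 - z)^\<beta> on the boundary of its disc, at z = 1: by the
  hockey-stick identity the partial sums are the sequence just shown to tend to 0.\<close>

lemma sums_pochhammer_over_fact:
  fixes \<beta> :: real
  assumes "\<beta> > 0"
  shows "(\<lambda>k. pochhammer (- \<beta>) k / fact k) sums 0"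
  using pochhammer_over_fact_tendsto_0[OF assms]
  by (simp add: sums_def_le sum_pochhammer_over_fact)

text \<open>The terms are O(m^(-\<beta> - 1)), because the factor
  \<open>rGamma_series (- \<beta>)\<close> converges and is therefore bounded.\<close>

lemma summable_abs_pochhammer_over_fact:
  fixes \<beta> :: real
  assumes "\<beta> > 0"
  shows "summable (\<lambda>k. \<bar>pochhammer (- \<beta>) k / fact k\<bar>)"
proof -
  have "Bseq (rGamma_series (- \<beta>))"
    using rGamma_series_LIMSEQ by (rule convergentI[THEN convergent_imp_Bseq])
  then obtain K where "K > 0" and K: "\<And>m. \<bar>rGamma_series (- \<beta>) m\<bar> \<le> K"
    unfolding Bseq_def by auto
  have "\<bar>pochhammer (- \<beta>) (Suc m) / fact (Suc m)\<bar> \<le> K * real m powr (- \<beta> - 1)"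
    if "m \<ge> 1" for m
  proof -
    have "\<bar>pochhammer (- \<beta>) (Suc m) / fact (Suc m)\<bar>
        = \<bar>rGamma_series (- \<beta>) m\<bar> * (real m powr (- \<beta>) / real (Suc m))"
      using that by (subst pochhammer_over_fact_eq_rGamma_series) (simp_all add: abs_mult)
    also have "\<dots> \<le> K * (real m powr (- \<beta>) / real m)"
      using that K \<open>K > 0\<close> by (intro mult_mono divide_left_mono) auto
    also have "real m powr (- \<beta>) / real m = real m powr (- \<beta> - 1)"
      using that by (simp add: powr_diff)
    finally show ?thesis .
  qed
  moreover have "summable (\<lambda>m. K * real m powr (- \<beta> - 1))"
    using assms by (intro summable_mult) (simp add: summable_real_powr_iff)
  ultimately have "summable (\<lambda>m. \<bar>pochhammer (- \<beta>) (Suc m) / fact (Suc m)\<bar>)"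
    using summable_comparison_test'[of "\<lambda>m. K * real m powr (- \<beta> - 1)" 1
        "\<lambda>m. \<bar>pochhammer (- \<beta>) (Suc m) / fact (Suc m)\<bar>"]
    unfolding real_norm_def abs_idempotent by blast
  then show ?thesis
    by (rule summable_Suc_iff[of "\<lambda>k. \<bar>pochhammer (- \<beta>) k / fact k\<bar>", THEN iffD1])
qed

lemma pochhammer_binomial_sums:
  fixes c z :: real
  assumes "\<bar>z\<bar> < 1"
  shows "(\<lambda>k. pochhammer c k / fact k * z ^ k) sums (1 - z) powr (- c)"
proof -
  have "(\<lambda>k. (- c gchoose k) * (- z) ^ k) sums (1 + (- z)) powr (- c)"
    by (rule gen_binomial_real) (use assms in auto)
  moreover have "(- c gchoose k) * (- z) ^ k = pochhammer c k / fact k * z ^ k" for k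
    by (simp add: gbinomial_pochhammer power_minus[of z])
  ultimately show ?thesis by simp
qed

lemma summable_abs_pochhammer_binomial:
  fixes c z :: real
  assumes "\<bar>z\<bar> < 1"
  shows "summable (\<lambda>k. \<bar>pochhammer c k / fact k * z ^ k\<bar>)"
proof -
  \<comment> \<open>A power series that converges at w converges absolutely at every point of
    smaller modulus.\<close>
  obtain w where w: "\<bar>z\<bar> < w" "w < 1" using assms dense by blast
  then have "summable (\<lambda>k. pochhammer c k / fact k * w ^ k)"
    using pochhammer_binomial_sums[of w c] by (simp add: sums_iff)
  from powser_insidea[OF this, of z] w show ?thesis by simp
qed

lemma set_integral_shifted_power:
  fixes a t :: real
  assumes "a \<le> t"
  shows "(LBINT \<tau>:{a..t}. (\<tau> - a) ^ k) = (t - a) ^ Suc k / real (Suc k)"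
proof -
  have "(LBINT \<tau>:{a..t}. (\<tau> - a) ^ k)
      = (t - a) ^ Suc k / real (Suc k) - (a - a) ^ Suc k / real (Suc k)"
    unfolding set_lebesgue_integral_def
  proof (rule integral_FTC_Icc[OF assms])
    fix \<tau>
    have "((\<lambda>\<tau>. (\<tau> - a) ^ Suc k / real (Suc k)) has_real_derivative
        real (Suc k) * (\<tau> - a) ^ k / real (Suc k)) (at \<tau> within {a..t})"
      by (rule derivative_eq_intros refl | simp del: of_nat_Suc power_Suc)+
    then show "((\<lambda>\<tau>. (\<tau> - a) ^ Suc k / real (Suc k)) has_vector_derivative (\<tau> - a) ^ k)
        (at \<tau> within {a..t})"
      by (simp del: of_nat_Suc power_Suc flip: has_real_derivative_iff_has_vector_derivative)
  qed (intro continuous_intros)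
  then show ?thesis by simp
qed

text \<open>With T = t - a and z = (\<tau> - a) / T the kernel is T^(\<alpha> - 1) (1 - z)^(\<alpha>
  - 1). Its binomial series may be integrated termwise against x because the L1 norms of the terms
  are summable.\<close>

lemma RL_integral_moment_sums:
  fixes a \<alpha> t :: real
  assumes "a < t" and "\<alpha> > 0" and cont: "continuous_on {a..t} x"
  shows "(\<lambda>k. pochhammer (1 - \<alpha>) k / (Gamma \<alpha> * fact k) * (t - a) powr (\<alpha> - 1 - real k)
              * (LBINT \<tau>:{a..t}. (\<tau> - a) ^ k * x \<tau>)) sums RL_integral a \<alpha> x t"
proof -
  define T where "T = t - a"
  define c where "c k = pochhammer (1 - \<alpha>) k / fact k" for k
  \<comment> \<open>The k-th term of the integrand without the constant T^(\<alpha> - 1) / Gamma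
    \<alpha>. The indicator turns integrals over {a..t} into integrals over the whole line.\<close>
  define f where "f k \<tau> = indicator {a..t} \<tau> *\<^sub>R (c k * ((\<tau> - a) / T) ^ k * x \<tau>)" for k \<tau>
  have T: "T > 0" using assms by (simp add: T_def)
  obtain M where "M > 0" and M: "\<bar>x \<tau>\<bar> \<le> M" if "\<tau> \<in> {a..t}" for \<tau>
    using compact_imp_bounded[OF compact_continuous_image[OF cont compact_Icc]]
    unfolding bounded_pos by auto
  have intf: "integrable lborel (f k)" for k
    unfolding f_def set_integrable_def[symmetric] using cont T
    by (intro borel_integrable_atLeastAtMost' continuous_intros) auto
  \<comment> \<open>The null set {t} is left out: there z = 1, and for \<alpha> < 1 the coefficients
    \<open>c k\<close> are not summable.\<close>
  have summ: "AE \<tau> in lborel. summable (\<lambda>k. norm (f k \<tau>))"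
    using AE_lborel_singleton[of t]
  proof eventually_elim
    case (elim \<tau>)
    show ?case
    proof (cases "\<tau> \<in> {a..t}")
      case True
      then have "\<bar>(\<tau> - a) / T\<bar> < 1" using elim T by (auto simp: T_def)
      from summable_mult2[OF summable_abs_pochhammer_binomial[OF this, of "1 - \<alpha>"], of "\<bar>x \<tau>\<bar>"]
      show ?thesis using True by (simp add: f_def c_def abs_mult)
    qed (simp add: f_def)
  qed
  have bound: "(\<integral>\<tau>. norm (f k \<tau>) \<partial>lborel)
      \<le> M * T / \<alpha> * \<bar>pochhammer (- \<alpha>) (Suc k) / fact (Suc k)\<bar>" for k
  proof -
    let ?g = "\<lambda>\<tau>. indicator {a..t} \<tau> *\<^sub>R (\<tau> - a) ^ k * (\<bar>c k\<bar> * M / T ^ k)"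
    have "(\<integral>\<tau>. norm (f k \<tau>) \<partial>lborel) \<le> (\<integral>\<tau>. ?g \<tau> \<partial>lborel)"
    proof (rule integral_mono)
      show "integrable lborel (\<lambda>\<tau>. norm (f k \<tau>))" using intf by (rule integrable_norm)
      show "integrable lborel ?g"
        unfolding set_integrable_def[symmetric]
        by (intro integrable_mult_left,
            fold set_integrable_def, intro borel_integrable_atLeastAtMost' continuous_intros)
      show "norm (f k \<tau>) \<le> ?g \<tau>" for \<tau>
      proof (cases "\<tau> \<in> {a..t}")
        case True
        then have "norm (f k \<tau>) = (\<bar>c k\<bar> * ((\<tau> - a) / T) ^ k) * \<bar>x \<tau>\<bar>"
          using T by (simp add: f_def abs_mult)
        also have "\<dots> \<le> (\<bar>c k\<bar> * ((\<tau> - a) / T) ^ k) * M"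
          using True T M by (intro mult_left_mono) auto
        finally show ?thesis using True by (simp add: power_divide field_simps)
      qed (simp add: f_def)
    qed
    also have "\<dots> = (LBINT \<tau>:{a..t}. (\<tau> - a) ^ k) * (\<bar>c k\<bar> * M / T ^ k)"
      by (simp add: set_lebesgue_integral_def)
    also have "\<dots> = M * T * (\<bar>c k\<bar> / real (Suc k))"
      using T assms(1) by (simp add: set_integral_shifted_power flip: T_def)
    \<comment> \<open>By \<open>pochhammer_rec\<close>,
      \<open>pochhammer (- \<alpha>) (Suc k)\<close> is -\<alpha> times
      \<open>pochhammer (1 - \<alpha>) k\<close>. So the divisor k + 1 gained by integration leads
      to the absolutely summable coefficients of (1 - z)^\<alpha>.\<close>
    also have "\<bar>c k\<bar> / real (Suc k) = \<bar>pochhammer (- \<alpha>) (Suc k) / fact (Suc k)\<bar> / \<alpha>"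
      using assms(2) by (simp add: c_def pochhammer_rec abs_mult divide_simps)
    finally show ?thesis by (simp only: times_divide_eq_right times_divide_eq_left)
  qed
  have norms: "summable (\<lambda>k. \<integral>\<tau>. norm (f k \<tau>) \<partial>lborel)"
  proof (rule summable_comparison_test')
    show "summable (\<lambda>k. M * T / \<alpha> * \<bar>pochhammer (- \<alpha>) (Suc k) / fact (Suc k)\<bar>)"
      by (intro summable_mult
            summable_Suc_iff[of "\<lambda>k. \<bar>pochhammer (- \<alpha>) k / fact k\<bar>", THEN iffD2]
            summable_abs_pochhammer_over_fact assms(2))
    show "norm (\<integral>\<tau>. norm (f k \<tau>) \<partial>lborel)
        \<le> M * T / \<alpha> * \<bar>pochhammer (- \<alpha>) (Suc k) / fact (Suc k)\<bar>" for k
      using bound[of k] by simp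
  qed
  have "(\<lambda>k. \<integral>\<tau>. f k \<tau> \<partial>lborel) sums (\<integral>\<tau>. (\<Sum>k. f k \<tau>) \<partial>lborel)"
    using intf summ norms by (rule sums_integral)
  then have sums: "(\<lambda>k. T powr (\<alpha> - 1) / Gamma \<alpha> * (\<integral>\<tau>. f k \<tau> \<partial>lborel)) sums
      (T powr (\<alpha> - 1) / Gamma \<alpha> * (\<integral>\<tau>. (\<Sum>k. f k \<tau>) \<partial>lborel))"
    by (rule sums_mult)
  have "T powr (\<alpha> - 1) * (\<integral>\<tau>. (\<Sum>k. f k \<tau>) \<partial>lborel)
      = (\<integral>\<tau>. T powr (\<alpha> - 1) * (\<Sum>k. f k \<tau>) \<partial>lborel)"
    by simp
  also have "\<dots> = (\<integral>\<tau>. indicator {a..t} \<tau> *\<^sub>R ((t - \<tau>) powr (\<alpha> - 1) * x \<tau>) \<partial>lborel)"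
  proof (rule integral_cong_AE)
    show "(\<lambda>\<tau>. T powr (\<alpha> - 1) * (\<Sum>k. f k \<tau>)) \<in> borel_measurable lborel"
      using borel_measurable_integrable[OF intf] by measurable
    \<comment> \<open>Since x is controlled only on {a..t}, measurability is proved for x cut off by
      the indicator.\<close>
    have "(\<lambda>\<tau>. indicator {a..t} \<tau> *\<^sub>R x \<tau>) \<in> borel_measurable lborel"
      using borel_integrable_atLeastAtMost'[OF cont] unfolding set_integrable_def
      by (rule borel_measurable_integrable)
    then have "(\<lambda>\<tau>. (t - \<tau>) powr (\<alpha> - 1) * (indicator {a..t} \<tau> *\<^sub>R x \<tau>)) \<in> borel_measurable lborel"
      by measurable
    then show "(\<lambda>\<tau>. indicator {a..t} \<tau> *\<^sub>R ((t - \<tau>) powr (\<alpha> - 1) * x \<tau>))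
        \<in> borel_measurable lborel"
      by (simp add: mult_ac)
    show "AE \<tau> in lborel. T powr (\<alpha> - 1) * (\<Sum>k. f k \<tau>)
        = indicator {a..t} \<tau> *\<^sub>R ((t - \<tau>) powr (\<alpha> - 1) * x \<tau>)"
      using AE_lborel_singleton[of t]
    proof eventually_elim
      case (elim \<tau>)
      show ?case
      proof (cases "\<tau> \<in> {a..t}")
        case True
        define z where "z = (\<tau> - a) / T"
        have z: "\<bar>z\<bar> < 1" using True elim T by (auto simp: T_def z_def)
        have "(\<lambda>k. f k \<tau>) sums ((1 - z) powr (\<alpha> - 1) * x \<tau>)"
          using sums_mult2[OF pochhammer_binomial_sums[OF z, of "1 - \<alpha>"], of "x \<tau>"] True
          by (simp add: f_def c_def z_def)
        then have "T powr (\<alpha> - 1) * (\<Sum>k. f k \<tau>) = (T * (1 - z)) powr (\<alpha> - 1) * x \<tau>"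
          using T z by (simp add: sums_iff powr_mult)
        also have "T * (1 - z) = t - \<tau>" using T by (simp add: z_def T_def field_simps)
        finally show ?thesis using True by simp
      qed (simp add: f_def)
    qed
  qed
  finally have "T powr (\<alpha> - 1) / Gamma \<alpha> * (\<integral>\<tau>. (\<Sum>k. f k \<tau>) \<partial>lborel) = RL_integral a \<alpha> x t"
    by (simp add: RL_integral_def set_lebesgue_integral_def)
  moreover have "T powr (\<alpha> - 1) / Gamma \<alpha> * (\<integral>\<tau>. f k \<tau> \<partial>lborel)
      = pochhammer (1 - \<alpha>) k / (Gamma \<alpha> * fact k) * (t - a) powr (\<alpha> - 1 - real k)
        * (LBINT \<tau>:{a..t}. (\<tau> - a) ^ k * x \<tau>)" for k
  proof -
    have "(\<integral>\<tau>. f k \<tau> \<partial>lborel)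
        = (\<integral>\<tau>. c k / T ^ k * (indicator {a..t} \<tau> *\<^sub>R ((\<tau> - a) ^ k * x \<tau>)) \<partial>lborel)"
      by (simp add: f_def power_divide field_simps)
    also have "\<dots> = c k / T ^ k * (LBINT \<tau>:{a..t}. (\<tau> - a) ^ k * x \<tau>)"
      unfolding set_lebesgue_integral_def by (rule integral_mult_right_zero)
    finally show ?thesis
      using T by (simp add: c_def powr_diff powr_realpow mult_ac flip: T_def)
  qed
  ultimately show ?thesis using sums by simp
qed

text \<open>Putting p = n - i + k makes p + 1 + i - n equal to k + 1, so the bracket in
  \<open>A_coeff\<close> lists the binomial coefficients from index 1 on.\<close>

lemma A_term_shift:
  "i < n \<Longrightarrow>
    A_term \<alpha> n i (n - i + k) = pochhammer (- (\<alpha> + real i)) (Suc k) / fact (Suc k)"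
  by (simp add: A_term_def)

text \<open>The full series sums to 0 and its term of index 0 is 1. The remaining sum thus cancels
  the 1 in the bracket of \<open>A_coeff\<close>.\<close>

lemma A_term_sums:
  assumes "\<alpha> > 0" "i < n"
  shows "(\<lambda>k. A_term \<alpha> n i (n - i + k)) sums (- 1)"
proof -
  have "(\<lambda>k. pochhammer (- (\<alpha> + real i)) (Suc k) / fact (Suc k)) sums (- 1)"
    using sums_pochhammer_over_fact[of "\<alpha> + real i"] assms(1)
    by (subst sums_Suc_iff) simp
  then show ?thesis using assms(2) by (simp only: A_term_shift)
qed

text \<open>For p = n + k the factor k + 1 in \<open>V_moment\<close> cancels against
  \<open>fact (k + 1)\<close> in \<open>B_coeff\<close>, leaving the k-th term of the moment
  expansion, which is free of n.\<close>

lemma B_term_shift: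
  "B_term a \<alpha> n x t (n + k)
     = pochhammer (1 - \<alpha>) k / (Gamma \<alpha> * fact k) * (t - a) powr (\<alpha> - 1 - real k)
       * (LBINT \<tau>:{a..t}. (\<tau> - a) ^ k * x \<tau>)"
proof -
  have "V_moment a n x (n + k) t = real (Suc k) * (LBINT \<tau>:{a..t}. (\<tau> - a) ^ k * x \<tau>)"
    by (simp add: V_moment_def mult.assoc)
  moreover have "B_coeff \<alpha> n (n + k) = pochhammer (1 - \<alpha>) k / (Gamma \<alpha> * fact k) / real (Suc k)"
    by (simp add: B_coeff_def)
  moreover have exponent: "\<alpha> + real n - 1 - real (n + k) = \<alpha> - 1 - real k"
    by simp
  ultimately show ?thesis
    unfolding B_term_def exponent by (simp del: of_nat_Suc)
qed

theorem theorem3p3: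
  fixes a b \<alpha> :: real and n :: nat and x :: "real \<Rightarrow> real"
  assumes "a < b" and "\<alpha> > 0" and "n \<ge> 1" and "Cn_on n {a..b} x"
  shows "\<forall>t\<in>{a<..b}.
           (\<forall>i<n. summable (\<lambda>k. A_term \<alpha> n i (n - i + k))) \<and>
           summable (\<lambda>k. B_term a \<alpha> n x t (n + k)) \<and>
           RL_integral a \<alpha> x t =
             (\<Sum>i=0..n-1. A_coeff \<alpha> n i * (t - a) powr (\<alpha> + real i) * deriv_within {a..b} i x t)
             + (\<Sum>k. B_term a \<alpha> n x t (n + k))"
proof
  fix t assume t: "t \<in> {a<..b}"
  \<comment> \<open>Index 0 in \<open>Cn_on\<close>, available because n \<ge> 1; it yields the
    continuity on {a..t} that the moment expansion asks for.\<close>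
  have "x differentiable_on {a..b}"
    using assms(3,4) by (force simp: Cn_on_def)
  then have "continuous_on {a..t} x"
    using t by (auto intro: continuous_on_subset[OF differentiable_imp_continuous_on])
  then have "(\<lambda>k. B_term a \<alpha> n x t (n + k)) sums RL_integral a \<alpha> x t"
    using RL_integral_moment_sums[of a t \<alpha> x] t assms(2) by (simp add: B_term_shift)
  moreover have A0: "A_coeff \<alpha> n i = 0" if "i < n" for i
    using A_term_sums[OF assms(2) that] by (simp add: A_coeff_def sums_iff)
  \<comment> \<open>For n \<ge> 1 the range 0..n-1 consists exactly of the i < n, where the
    coefficients vanish.\<close>
  have "(\<Sum>i=0..n-1. A_coeff \<alpha> n i * (t - a) powr (\<alpha> + real i) * deriv_within {a..b} i x t) = 0"
    using assms(3) by (intro sum.neutral) (auto simp: A0)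
  ultimately show "(\<forall>i<n. summable (\<lambda>k. A_term \<alpha> n i (n - i + k))) \<and>
      summable (\<lambda>k. B_term a \<alpha> n x t (n + k)) \<and>
      RL_integral a \<alpha> x t =
        (\<Sum>i=0..n-1. A_coeff \<alpha> n i * (t - a) powr (\<alpha> + real i) * deriv_within {a..b} i x t)
        + (\<Sum>k. B_term a \<alpha> n x t (n + k))"
    using A_term_sums[OF assms(2)] by (auto simp: sums_iff)
qed

end
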